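(* Let $\{H_j\}_{j=0}^\infty$ be the family of Hermite polynomials, let $$\Pi_n(\mathrm{sgn})(x)=\sum_{j=0}^n\hat{s}_j\,H_j(x)$$ be the degree-$n$ expansion of the sign function $\mathrm{sgn}$ on $\mathbb{R}$ in the Hermite polynomials, and let $x_{n,+}$ be the smallest positive critical point of $\Pi_n(\mathrm{sgn})$. Then $$\lim_{n\to\infty}\Pi_n(\mathrm{sgn})(x_{n,+})=\frac{2}{\pi}\int_0^\pi\frac{\sin t}{t}\,\mathrm{d}t.$$
   Context: The Hermite polynomials are the (physicists') polynomials given by $$H_{2n}(x)=(-1)^n2^{2n}n!\,L_n^{(-1/2)}(x^2),\qquad H_{2n+1}(x)=(-1)^n2^{2n+1}n!\,x\,L_n^{(1/2)}(x^2),$$ where $L_n^{(\alpha)}(x)=\sum_{j=0}^n\binom{n+\alpha}{n-j}\frac{(-x)^j}{j!}$ (generalized binomial coefficients). They are orthogonal on $(-\infty,\infty)$ with respect to the inner product $\langle f,g\rangle=\int_{-\infty}^\infty f(x)g(x)e^{-x^2}\,\mathrm{d}x$, with $\|H_k\|^2=\langle H_k,H_k\rangle=\sqrt{\pi}\,2^k\,k!$. Here $\mathrm{sgn}(x)=1$ for $x>0$ and $\mathrm{sgn}(x)=-1$ for $x<0$ (the value at $0$ is irrelevant), and the expansion coefficients are the orthogonal projection coefficients $$\hat{s}_j=\frac{\langle\mathrm{sgn},H_j\rangle}{\|H_j\|^2}=\frac{1}{\|H_j\|^2}\int_{-\infty}^\infty\mathrm{sgn}(x)\,H_j(x)\,e^{-x^2}\,\mathrm{d}x.$$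 A critical point of the polynomial $\Pi_n(\mathrm{sgn})$ is a real zero of its derivative. The point $x_{n,+}$ need not exist for small $n$; the assertion is understood to be that it exists for all sufficiently large $n$ and that the stated limit over such $n$ holds. *)

theory Defs
  imports "HOL-Analysis.Analysis" "HOL-Computational_Algebra.Polynomial"
begin

definition laguerre_poly :: "real \<Rightarrow> nat \<Rightarrow> real poly" where
  "laguerre_poly \<alpha> n =
     (\<Sum>j\<le>n. monom (((real n + \<alpha>) gchoose (n - j)) * (-1) ^ j / fact j) j)"

(* Physicists' normalisation.  With m = k div 2 the power 2 ^ k is 2 ^ (2 m) for even k
   and 2 ^ (2 m + 1) for odd k. *)
definition hermite_poly :: "nat \<Rightarrow> real poly" where
  "hermite_poly k = (let m = k div 2; c = (-1) ^ m * 2 ^ k * fact m in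
     if even k then smult c (pcompose (laguerre_poly (-1/2) m) (monom 1 2))
     else smult c (monom 1 1 * pcompose (laguerre_poly (1/2) m) (monom 1 2)))"

definition hermite_inner :: "(real \<Rightarrow> real) \<Rightarrow> (real \<Rightarrow> real) \<Rightarrow> real" where
  "hermite_inner f g = (LBINT x. f x * g x * exp (- (x ^ 2)))"

definition hermite_coeff :: "(real \<Rightarrow> real) \<Rightarrow> nat \<Rightarrow> real" where
  "hermite_coeff f j =
     hermite_inner f (poly (hermite_poly j)) /
     hermite_inner (poly (hermite_poly j)) (poly (hermite_poly j))"

definition hermite_expansion :: "nat \<Rightarrow> (real \<Rightarrow> real) \<Rightarrow> real poly" where
  "hermite_expansion n f = (\<Sum>j\<le>n. smult (hermite_coeff f j) (hermite_poly j))"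

definition critical_point :: "real poly \<Rightarrow> real \<Rightarrow> bool" where
  "critical_point p x \<longleftrightarrow> poly (pderiv p) x = 0"

definition smallest_pos_critical_point :: "real poly \<Rightarrow> real \<Rightarrow> bool" where
  "smallest_pos_critical_point p x \<longleftrightarrow>
     x > 0 \<and> critical_point p x \<and> (\<forall>y. y > 0 \<and> critical_point p y \<longrightarrow> x \<le> y)"

end

theory Submission
  imports Defs "HOL-Probability.Sinc_Integral" "HOL-Real_Asymp.Real_Asymp"
begin

text \<open>
  Integration by parts gives \<open>\<langle>sgn, H (n + 1)\<rangle> = 2 * H n 0\<close>, so differentiating the expansion
  yields twice the Christoffel--Darboux kernel at \<open>(x, 0)\<close>, which collapses to the single
  Laguerre polynomial \<open>2 / sqrt pi * L m (x\<^sup>2)\<close> with parameter \<open>1/2\<close> and \<open>m = (n - 1) div 2\<close>.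
  Under \<open>x = s / (2 * sqrt m)\<close> this derivative, suitably normalised, converges to \<open>sin s / s\<close>
  uniformly on \<open>[0, 4]\<close> (Tannery's theorem).  Hence the smallest positive critical point is
  asymptotic to \<open>pi / (2 * sqrt m)\<close>, and by the mean value theorem the expansion itself is
  asymptotic to \<open>2 / pi * Si s\<close>.
\<close>

section \<open>Coefficient identities for Laguerre polynomials\<close>

lemma coeff_laguerre_poly:
  "coeff (laguerre_poly \<alpha> n) j =
    (if j \<le> n then ((real n + \<alpha>) gchoose (n - j)) * (-1) ^ j / fact j else 0)"
  by (simp add: laguerre_poly_def coeff_sum sum.delta)

lemma poly_laguerre_poly:
  "poly (laguerre_poly \<alpha> n) x =
    (\<Sum>j\<le>n. ((real n + \<alpha>) gchoose (n - j)) * (-1) ^ j / fact j * x ^ j)"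
  by (simp add: laguerre_poly_def poly_sum poly_monom)

lemma laguerre_poly_0 [simp]: "laguerre_poly \<alpha> 0 = 1"
  by (simp add: laguerre_poly_def)

lemma pderiv_laguerre_poly_Suc:
  "pderiv (laguerre_poly \<alpha> (Suc n)) = - laguerre_poly (\<alpha> + 1) n"
  by (rule poly_eqI) (simp add: coeff_pderiv coeff_laguerre_poly add_ac divide_simps)

text \<open>The operator alpha + x d/dx multiplies coefficient j by alpha + j, which the absorption
  identity (r - k) binom(r, k) = r binom(r - 1, k) turns into a shift of the parameter. With alpha =
  1/2 it links the odd Hermite polynomials to the even ones.\<close>

lemma laguerre_poly_lower_parameter:
  "smult \<alpha> (laguerre_poly \<alpha> n) + monom 1 1 * pderiv (laguerre_poly \<alpha> n) =
    smult (real n + \<alpha>) (laguerre_poly (\<alpha> - 1) n)"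
proof (rule poly_eqI)
  fix j
  have X: "coeff (monom 1 1 * pderiv p) j = real j * coeff p j" for p :: "real poly"
    by (cases j) (simp_all add: monom_altdef coeff_pderiv)
  have "(\<alpha> + real j) * ((real n + \<alpha>) gchoose (n - j)) =
        (real n + \<alpha>) * ((real n + \<alpha> - 1) gchoose (n - j))" if "j \<le> n"
    using gbinomial_absorb_comp[of "real n + \<alpha>" "n - j"] that
    by (simp add: of_nat_diff algebra_simps)
  then have "(\<alpha> + real j) * ((real n + \<alpha>) gchoose (n - j)) * ((-1) ^ j / fact j) =
        (real n + \<alpha>) * ((real n + \<alpha> - 1) gchoose (n - j)) * ((-1) ^ j / fact j)" if "j \<le> n"
    using that by simp
  then show "coeff (smult \<alpha> (laguerre_poly \<alpha> n) + monom 1 1 * pderiv (laguerre_poly \<alpha> n)) j =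
      coeff (smult (real n + \<alpha>) (laguerre_poly (\<alpha> - 1) n)) j"
    unfolding coeff_add coeff_smult X coeff_laguerre_poly
    by (cases "j \<le> n") (simp_all add: distrib_right add_diff_eq mult.assoc add_divide_distrib)
qed

section \<open>Hermite polynomials: values at 0, derivatives, recurrences, kernel at 0\<close>

lemma hermite_poly_even:
  "hermite_poly (2 * m) =
    smult ((-1) ^ m * 2 ^ (2 * m) * fact m) (pcompose (laguerre_poly (-1/2) m) (monom 1 2))"
  by (simp add: hermite_poly_def Let_def)

lemma hermite_poly_odd:
  "hermite_poly (Suc (2 * m)) =
    smult ((-1) ^ m * 2 ^ Suc (2 * m) * fact m)
      (monom 1 1 * pcompose (laguerre_poly (1/2) m) (monom 1 2))"
  by (simp add: hermite_poly_def Let_def)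

lemma hermite_poly_0 [simp]: "hermite_poly 0 = 1"
  by (simp add: hermite_poly_def pcompose_1)

lemma hermite_poly_1: "hermite_poly (Suc 0) = [:0, 2:]"
  by (simp add: hermite_poly_def monom_altdef pcompose_1)

lemma hermite_poly_odd_at_0 [simp]: "poly (hermite_poly (Suc (2 * m))) 0 = 0"
  by (simp add: hermite_poly_odd poly_monom)

text \<open>The constant coefficient of the Laguerre polynomial is (1/2)_m / m! with a rising
  factorial, and the duplication formula (2m)! = 4^m (1/2)_m m! removes the half-integers.\<close>

lemma hermite_poly_even_at_0: "poly (hermite_poly (2 * m)) 0 = (-1) ^ m * fact (2 * m) / fact m"
proof -
  have "fact m * ((real m - 1/2) gchoose m) = pochhammer (1/2) m"
    using gbinomial_pochhammer'[of "real m - 1/2" m] by simp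
  moreover have "fact (2 * m) = 4 ^ m * (pochhammer (1/2) m :: real) * fact m"
    using fact_double[of m, where 'a = real] by (simp add: power_mult)
  moreover have "poly (laguerre_poly (-1/2) m) 0 = ((real m - 1/2) gchoose m)"
    by (simp add: poly_0_coeff_0 coeff_laguerre_poly)
  ultimately show ?thesis
    by (simp add: hermite_poly_even poly_pcompose poly_monom power_mult)
qed

text \<open>For even n the derivative of x L(x^2) has the form handled by
  \<open>laguerre_poly_lower_parameter\<close> at 1/2; for odd n,
  \<open>pderiv_laguerre_poly_Suc\<close> raises the parameter from -1/2 to 1/2.\<close>

lemma pderiv_hermite_poly_Suc: "pderiv (hermite_poly (Suc n)) = smult (2 * real (Suc n)) (hermite_poly n)"
proof (cases "even n")
  case True
  then obtain m where n: "n = 2 * m" by auto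
  let ?L = "laguerre_poly (1/2) m"
  have "pderiv (monom 1 1 * pcompose ?L (monom 1 2)) = 
     smult 2 (pcompose (smult (1/2) ?L + monom 1 1 * pderiv ?L) (monom (1::real) 2))"
    by (rule poly_eq_poly_eq_iff[THEN iffD1, OF ext])
      (simp add: pderiv_mult pderiv_pcompose pderiv_monom poly_pcompose poly_monom
        power2_eq_square algebra_simps)
  also have "\<dots> = smult (2 * real m + 1) (pcompose (laguerre_poly (-1/2) m) (monom 1 2))"
    unfolding laguerre_poly_lower_parameter by (simp add: pcompose_smult distrib_left)
  finally show ?thesis
    unfolding n hermite_poly_odd hermite_poly_even pderiv_smult
    by (simp add: algebra_simps)
next
  case False
  then obtain m where n: "n = Suc (2 * m)" using oddE by fastforce
  have e: "Suc n = 2 * Suc m" using n by simp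
  show ?thesis
    unfolding e hermite_poly_even unfolding n hermite_poly_odd
    by (rule poly_eq_poly_eq_iff[THEN iffD1, OF ext])
      (simp add: pderiv_smult pderiv_pcompose pderiv_laguerre_poly_Suc pcompose_uminus
        poly_monom poly_pcompose pderiv_monom algebra_simps)
qed

text \<open>This is how the three-term recurrence is integrated: each instance is recovered from its
  derivative and its value at 0.\<close>

lemma poly_eqI_pderiv:
  fixes p q :: "real poly"
  assumes "pderiv p = pderiv q" "poly p 0 = poly q 0"
  shows "p = q"
proof -
  have "pderiv (p - q) = 0"
    using assms(1) by (simp add: pderiv_diff)
  then obtain c where "p - q = [:c:]"
    using pderiv_eq_0_iff degree_eq_zeroE by metis
  moreover have "poly (p - q) 0 = 0"
    using assms(2) by simp
  ultimately show ?thesis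
    by simp
qed

lemma hermite_poly_recurrence_at_0:
  "poly (hermite_poly (Suc (Suc n))) 0 = - 2 * real (Suc n) * poly (hermite_poly n) 0"
proof (cases "even n")
  case True
  then obtain m where n: "n = 2 * m" by auto
  have e: "Suc (Suc n) = 2 * Suc m" using n by simp
  have f1: "fact (2 * Suc m) = 2 * (real m + 1) * real (Suc (2 * m)) * fact (2 * m)"
    by simp
  have f2: "fact (Suc m) = (real m + 1) * fact m"
    by simp
  show ?thesis
    unfolding e unfolding n hermite_poly_even_at_0 f1 f2
    by (simp add: divide_simps del: fact_Suc) (simp add: algebra_simps)
next
  case False
  then obtain m where n: "n = Suc (2 * m)" using oddE by fastforce
  then show ?thesis
    using hermite_poly_odd_at_0[of "Suc m"] by simp
qed

text \<open>In the induction step, differentiating the right side yields 2 H(n+2) plus 2(n+2) times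
  the right side of the previous instance; \<open>hermite_poly_recurrence_at_0\<close> fixes the
  constant of integration.\<close>

lemma hermite_poly_recurrence:
  "hermite_poly (Suc (Suc n)) =
    [:0, 2:] * hermite_poly (Suc n) - smult (2 * real (Suc n)) (hermite_poly n)"
proof (induction n)
  case 0
  show ?case
    by (rule poly_eqI_pderiv)
      (simp_all add: pderiv_hermite_poly_Suc hermite_poly_recurrence_at_0 hermite_poly_1
        pderiv_mult pderiv_diff pderiv_smult pderiv_pCons)
next
  case (Suc n)
  let ?H = hermite_poly
  have "pderiv ([:0, 2:] * ?H (Suc (Suc n)) - smult (2 * real (Suc (Suc n))) (?H (Suc n))) =
      smult 2 (?H (Suc (Suc n))) + smult (2 * real (Suc (Suc n)))
        ([:0, 2:] * ?H (Suc n) - smult (2 * real (Suc n)) (?H n))"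
    unfolding pderiv_diff pderiv_mult pderiv_smult pderiv_hermite_poly_Suc
    by (simp add: pderiv_pCons algebra_simps smult_diff_right del: of_nat_Suc)
  also have "\<dots> = pderiv (?H (Suc (Suc (Suc n))))"
    unfolding Suc.IH[symmetric] pderiv_hermite_poly_Suc smult_add_left[symmetric]
    by (simp add: algebra_simps)
  finally show ?case
    by (rule poly_eqI_pderiv[OF sym]) (simp_all add: hermite_poly_recurrence_at_0 del: of_nat_Suc)
qed

text \<open>Equivalently, H(n+1) exp(-x^2) is minus the derivative of H(n) exp(-x^2); this turns
  integrals against H(n+1) into boundary terms.\<close>

lemma hermite_poly_Suc: "hermite_poly (Suc n) = [:0, 2:] * hermite_poly n - pderiv (hermite_poly n)"
  by (cases n) (simp_all add: hermite_poly_1 hermite_poly_recurrence pderiv_hermite_poly_Suc del: of_nat_Suc)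

text \<open>The weights 2^k k! are the squared norms up to sqrt pi, so the sum is, up to that
  factor, the reproducing kernel at (x, 0). The induction telescopes by the recurrence at x and at
  0.\<close>

lemma christoffel_darboux:
  "x * (\<Sum>k\<le>n. poly (hermite_poly k) 0 * poly (hermite_poly k) x / (2 ^ k * fact k)) =
   (poly (hermite_poly (Suc n)) x * poly (hermite_poly n) 0 -
    poly (hermite_poly n) x * poly (hermite_poly (Suc n)) 0) / (2 ^ Suc n * fact n)"
proof (induction n)
  case (Suc n)
  show ?case
    unfolding sum.atMost_Suc distrib_left Suc.IH
    unfolding hermite_poly_recurrence[of n] hermite_poly_recurrence_at_0 poly_diff poly_smult poly_mult
      fact_Suc power_Suc
    by (simp add: divide_simps del: of_nat_Suc) (simp add: algebra_simps del: of_nat_Suc)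
qed (simp add: hermite_poly_1)

section \<open>Gaussian integrals and Hermite inner products\<close>

lemma integrable_power_gaussian: "integrable lborel (\<lambda>x::real. x ^ k * exp (- x\<^sup>2))"
proof (cases "even k")
  case True
  then obtain m where k: "k = 2 * m" by auto
  show ?thesis
    using has_bochner_integral_even_function[OF gaussian_moment_even_pos[where k = m]]
    by (auto simp: k mult.commute has_bochner_integral_iff)
next
  case False
  then obtain m where k: "k = 2 * m + 1" using oddE by blast
  show ?thesis
    using has_bochner_integral_odd_function[OF gaussian_moment_odd_pos[where k = m]]
    by (auto simp: k mult.commute has_bochner_integral_iff)
qed

lemma integrable_poly_gaussian: "integrable lborel (\<lambda>x::real. poly p x * exp (- x\<^sup>2))"
  unfolding poly_altdef sum_distrib_right mult.assoc
  by (intro Bochner_Integration.integrable_sum integrable_mult_right integrable_power_gaussian)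

lemma poly_gaussian_at_top: "((\<lambda>x::real. poly p x * exp (- x\<^sup>2)) \<longlongrightarrow> 0) at_top"
proof -
  have "((\<lambda>x::real. x ^ k * exp (- x\<^sup>2)) \<longlongrightarrow> 0) at_top" for k
    by real_asymp
  then show ?thesis
    unfolding poly_altdef sum_distrib_right mult.assoc
    by (intro tendsto_null_sum tendsto_mult_right_zero)
qed

lemma poly_gaussian_at_bot: "((\<lambda>x::real. poly p x * exp (- x\<^sup>2)) \<longlongrightarrow> 0) at_bot"
  using poly_gaussian_at_top[of "pcompose p [:0, -1:]"]
  by (simp add: filterlim_at_bot_mirror poly_pcompose)

lemma poly_gaussian_has_derivative:
  "((\<lambda>x::real. poly p x * exp (- x\<^sup>2)) has_real_derivative
    poly (pderiv p - [:0, 2:] * p) x * exp (- x\<^sup>2)) (at x)"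
  by (auto intro!: derivative_eq_intros simp: algebra_simps)

text \<open>The function q exp(-x^2) is the derivative of p exp(-x^2), which equals p(0) at 0 and
  tends to 0 at both infinities, so the fundamental theorem of calculus leaves only boundary
  values.\<close>

lemma
  fixes p :: "real poly"
  defines "q \<equiv> pderiv p - [:0, 2:] * p"
  shows integral_poly_gaussian_pos: "(LBINT x:{0<..}. poly q x * exp (- x\<^sup>2)) = - poly p 0"
    and integral_poly_gaussian_neg: "(LBINT x:{..<0}. poly q x * exp (- x\<^sup>2)) = poly p 0"
    and integral_poly_gaussian: "(LBINT x. poly q x * exp (- x\<^sup>2)) = 0"
proof -
  have D: "((\<lambda>x. poly p x * exp (- x\<^sup>2)) has_vector_derivative poly q x * exp (- x\<^sup>2)) (at x)" for x
    using poly_gaussian_has_derivative[of p x]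
    by (simp add: q_def has_real_derivative_iff_has_vector_derivative)
  have I: "set_integrable lborel A (\<lambda>x. poly q x * exp (- x\<^sup>2))" if "A \<in> sets lborel" for A
    unfolding set_integrable_def
    using integrable_mult_indicator[OF that integrable_poly_gaussian] by simp
  have C: "isCont (\<lambda>x. poly q x * exp (- x\<^sup>2)) x" for x
    by (intro continuous_intros)
  have C0: "((\<lambda>x. poly p x * exp (- x\<^sup>2)) \<longlongrightarrow> poly p 0) (at 0 within S)" for S
    by (rule tendsto_eq_intros refl tendsto_poly)+ simp
  have "(LBINT x=ereal 0..\<infinity>. poly q x * exp (- x\<^sup>2)) = 0 - poly p 0"
    by (rule interval_integral_FTC_integrable[OF _ D C I])
      (simp_all add: ereal_tendsto_simps poly_gaussian_at_top C0)
  then show pos: "(LBINT x:{0<..}. poly q x * exp (- x\<^sup>2)) = - poly p 0"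
    by (simp add: interval_lebesgue_integral_def einterval_eq)
  have "(LBINT x=-\<infinity>..ereal 0. poly q x * exp (- x\<^sup>2)) = poly p 0 - 0"
    by (rule interval_integral_FTC_integrable[OF _ D C I])
      (simp_all add: ereal_tendsto_simps poly_gaussian_at_bot C0)
  then show neg: "(LBINT x:{..<0}. poly q x * exp (- x\<^sup>2)) = poly p 0"
    by (simp add: interval_lebesgue_integral_def einterval_eq)
  have "(LBINT x=-\<infinity>..\<infinity>. poly q x * exp (- x\<^sup>2)) = 0 - 0"
    by (rule interval_integral_FTC_integrable[OF _ D C I])
      (simp_all add: ereal_tendsto_simps poly_gaussian_at_bot poly_gaussian_at_top)
  then show "(LBINT x. poly q x * exp (- x\<^sup>2)) = 0"
    by (simp add: interval_lebesgue_integral_def einterval_eq set_lebesgue_integral_def)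
qed

lemma hermite_inner_sgn_hermite_poly_Suc:
  "hermite_inner sgn (poly (hermite_poly (Suc n))) = 2 * poly (hermite_poly n) 0"
proof -
  let ?h = "hermite_poly n"
  let ?q = "pderiv ?h - [:0, 2:] * ?h"
  let ?f = "\<lambda>x. poly ?q x * exp (- x\<^sup>2)"
  \<comment> \<open>Here \<open>?q\<close> is minus \<open>hermite_poly (Suc n)\<close>, so the
    half-lines carry signs opposite to those of sgn.\<close>
  have "hermite_inner sgn (poly (hermite_poly (Suc n))) =
      (LBINT x. indicator {..<0} x *\<^sub>R ?f x - indicator {0<..} x *\<^sub>R ?f x)"
    unfolding hermite_inner_def hermite_poly_Suc[of n]
    by (intro Bochner_Integration.integral_cong)
      (auto simp: indicator_def sgn_if algebra_simps)
  also have "\<dots> = (LBINT x:{..<0}. ?f x) - (LBINT x:{0<..}. ?f x)"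
    unfolding set_lebesgue_integral_def
    by (intro Bochner_Integration.integral_diff integrable_mult_indicator integrable_poly_gaussian) auto
  also have "\<dots> = 2 * poly ?h 0"
    unfolding integral_poly_gaussian_pos integral_poly_gaussian_neg by simp
  finally show ?thesis .
qed

text \<open>Differentiation is adjoint to the raising operator p -> 2 x p - p': the two integrands
  differ by the derivative of H(n) p exp(-x^2), whose integral over the line is 0.\<close>

lemma hermite_inner_hermite_poly_Suc:
  "hermite_inner (poly (hermite_poly (Suc n))) (poly p) =
    hermite_inner (poly (hermite_poly n)) (poly (pderiv p))"
proof -
  let ?h = "hermite_poly n"
  have "hermite_inner (poly ?h) (poly (pderiv p)) - hermite_inner (poly (hermite_poly (Suc n))) (poly p) =
     (LBINT x. poly (?h * pderiv p) x * exp (- x\<^sup>2) - poly (hermite_poly (Suc n) * p) x * exp (- x\<^sup>2))"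
    unfolding hermite_inner_def
    by (subst Bochner_Integration.integral_diff[OF integrable_poly_gaussian integrable_poly_gaussian]) simp
  also have "\<dots> = (LBINT x. poly (pderiv (?h * p) - [:0, 2:] * (?h * p)) x * exp (- x\<^sup>2))"
    unfolding hermite_poly_Suc[of n]
    by (intro Bochner_Integration.integral_cong) (auto simp: pderiv_mult algebra_simps)
  also have "\<dots> = 0"
    by (rule integral_poly_gaussian)
  finally show ?thesis by simp
qed

text \<open>Adjointness and the derivative rule give ||H(n+1)||^2 = 2(n+1) ||H(n)||^2, starting from
  the Gaussian integral sqrt pi.\<close>

lemma hermite_inner_hermite_poly_self:
  "hermite_inner (poly (hermite_poly n)) (poly (hermite_poly n)) = sqrt pi * 2 ^ n * fact n"
proof (induction n)
  case 0
  have "has_bochner_integral lborel (\<lambda>x::real. exp (- x\<^sup>2)) (2 *\<^sub>R (sqrt pi / 2))"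
    by (rule has_bochner_integral_even_function[OF gaussian_moment_0]) simp
  then show ?case
    by (simp add: hermite_inner_def has_bochner_integral_iff)
next
  case (Suc n)
  have "hermite_inner (poly (hermite_poly n)) (poly (smult c (hermite_poly n))) =
      c * hermite_inner (poly (hermite_poly n)) (poly (hermite_poly n))" for c
    by (simp add: hermite_inner_def mult.left_commute mult.assoc)
  then show ?case
    by (simp add: hermite_inner_hermite_poly_Suc pderiv_hermite_poly_Suc Suc.IH del: of_nat_Suc)
qed

section \<open>The derivative of the expansion as a Laguerre polynomial\<close>

lemma smult_sum_right: "smult c (\<Sum>i\<in>S. f i) = (\<Sum>i\<in>S. smult c (f i))"
  by (induction S rule: infinite_finite_induct) (simp_all add: smult_add_right)

lemma pderiv_sum: "pderiv (\<Sum>i\<in>S. f i) = (\<Sum>i\<in>S. pderiv (f i))"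
  by (induction S rule: infinite_finite_induct) (simp_all add: pderiv_add)

text \<open>In the term of index k + 1 the factor 2(k+1) from differentiation reduces 2^(k+1) (k+1)!
  to 2^k k!, so what remains is the kernel at (x, 0).\<close>

lemma pderiv_hermite_expansion_Suc:
  "pderiv (hermite_expansion (Suc n) sgn) =
    smult (2 / sqrt pi) (\<Sum>k\<le>n. smult (poly (hermite_poly k) 0 / (2 ^ k * fact k)) (hermite_poly k))"
proof -
  have "hermite_expansion (Suc n) sgn = smult (hermite_coeff sgn 0) 1 +
      (\<Sum>k\<le>n. smult (hermite_coeff sgn (Suc k)) (hermite_poly (Suc k)))"
    unfolding hermite_expansion_def sum.atMost_Suc_shift by simp
  moreover have "smult (hermite_coeff sgn (Suc k)) (pderiv (hermite_poly (Suc k))) =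
      smult (2 / sqrt pi) (smult (poly (hermite_poly k) 0 / (2 ^ k * fact k)) (hermite_poly k))" for k
    by (simp add: hermite_coeff_def pderiv_hermite_poly_Suc hermite_inner_sgn_hermite_poly_Suc
      hermite_inner_hermite_poly_self divide_simps mult_ac del: of_nat_Suc)
  ultimately show ?thesis
    by (simp add: pderiv_add pderiv_smult pderiv_sum smult_sum_right)
qed

text \<open>Supplies the initial value matching Si 0 = 0. The coefficient of index k + 1 is
  proportional to H(k)(0), and of two consecutive indices one is odd, where H vanishes at 0.\<close>

lemma hermite_expansion_sgn_at_0: "poly (hermite_expansion n sgn) 0 = 0"
proof -
  have "hermite_coeff sgn k * poly (hermite_poly k) 0 = 0" for k
  proof (cases k)
    case 0
    \<comment> \<open>The substitution x -> -x shows that this integral equals its own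
      negative.\<close>
    have "hermite_inner sgn (poly 1) = (LBINT x. - (sgn x * 1 * exp (- x\<^sup>2)))"
      unfolding hermite_inner_def
      by (subst lborel_integral_real_affine[of "-1" _ 0]) (simp_all add: sgn_minus)
    then have "hermite_inner sgn (poly 1) = 0"
      by (simp add: hermite_inner_def)
    with 0 show ?thesis by (simp add: hermite_coeff_def)
  next
    case (Suc j)
    have "poly (hermite_poly j) 0 = 0 \<or> poly (hermite_poly (Suc j)) 0 = 0"
      using hermite_poly_odd_at_0 by (metis evenE oddE Suc_eq_plus1)
    with Suc show ?thesis
      by (auto simp: hermite_coeff_def hermite_inner_sgn_hermite_poly_Suc)
  qed
  then show ?thesis
    by (simp only: hermite_expansion_def poly_sum poly_smult sum.neutral_const)
qed

text \<open>At even top degree 2m, Christoffel--Darboux keeps a single product because H(2m+1)(0) =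
  0, and its constants cancel to x L(x^2). An odd top degree only adds a vanishing term.\<close>

lemma poly_pderiv_hermite_expansion_sgn:
  assumes "n > 0"
  shows "pderiv (hermite_expansion n sgn) =
    smult (2 / sqrt pi) (pcompose (laguerre_poly (1/2) ((n - 1) div 2)) (monom 1 2))"
proof -
  define m where "m = (n - 1) div 2"
  let ?H = hermite_poly
  let ?L = "pcompose (laguerre_poly (1/2) m) (monom (1::real) 2)"
  let ?K = "\<lambda>n. \<Sum>k\<le>n. smult (poly (?H k) 0 / (2 ^ k * fact k)) (?H k)"
  have K: "x * poly (?K n) x =
      (poly (?H (Suc n)) x * poly (?H n) 0 - poly (?H n) x * poly (?H (Suc n)) 0) / (2 ^ Suc n * fact n)"
    for n x
    using christoffel_darboux[of x n] by (simp add: poly_sum)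
  have "x * poly (?K (2 * m)) x = x * poly ?L x" for x
    unfolding K hermite_poly_odd_at_0 hermite_poly_even_at_0
    by (simp add: hermite_poly_odd poly_monom power_mult_distrib[symmetric])
  \<comment> \<open>The factor x is cancelled in the polynomial ring, which also covers the point x
    = 0.\<close>
  then have "[:0, 1:] * ?K (2 * m) = [:0, 1:] * ?L"
    by (intro poly_eq_poly_eq_iff[THEN iffD1, OF ext]) simp
  then have e: "?K (2 * m) = ?L"
    using mult_left_cancel[of "[:0, 1 :: real:]" "?K (2 * m)" ?L] by simp
  have o: "?K (Suc (2 * m)) = ?K (2 * m)"
    by simp
  have "n - 1 = 2 * m \<or> n - 1 = Suc (2 * m)"
    unfolding m_def by presburger
  then have "?K (n - 1) = ?L"
  proof
    assume k: "n - 1 = 2 * m"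
    show ?thesis unfolding k e ..
  next
    assume k: "n - 1 = Suc (2 * m)"
    show ?thesis unfolding k o e ..
  qed
  with pderiv_hermite_expansion_Suc[of "n - 1"] assms show ?thesis
    by (simp add: m_def)
qed

section \<open>Mehler--Heine limit of the rescaled Laguerre polynomial, with its normalising
  constant\<close>

text \<open>This is \<open>fact m / (fact (m - j) * m ^ j)\<close>; in product form it vanishes for
  \<open>j > m > 0\<close>, so that sums over \<open>j \<le> m\<close> extend to series.\<close>

definition falling_ratio :: "nat \<Rightarrow> nat \<Rightarrow> real" where
  "falling_ratio m j = (\<Prod>i<j. 1 - real i / real m)"

lemma falling_ratio_eq_0: "0 < m \<Longrightarrow> m < j \<Longrightarrow> falling_ratio m j = 0"
  by (auto simp: falling_ratio_def intro!: prod_zero)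

lemma falling_ratio_bounds:
  assumes "0 < m"
  shows "0 \<le> falling_ratio m j" "falling_ratio m j \<le> 1"
proof -
  have "0 \<le> falling_ratio m j \<and> falling_ratio m j \<le> 1"
  proof (cases "j \<le> m")
    case True
    then show ?thesis
      using assms unfolding falling_ratio_def by (intro conjI prod_nonneg prod_le_1) auto
  next
    case False
    then show ?thesis using falling_ratio_eq_0[OF assms] by simp
  qed
  then show "0 \<le> falling_ratio m j" "falling_ratio m j \<le> 1" by auto
qed

lemma falling_ratio_tendsto: "(\<lambda>m. falling_ratio m j) \<longlonglongrightarrow> 1"
proof -
  have "(\<lambda>m. 1 - real i / real m) \<longlonglongrightarrow> 1" for i
    by real_asymp
  then have "(\<lambda>m. \<Prod>i<j. 1 - real i / real m) \<longlonglongrightarrow> (\<Prod>i<j. 1)"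
    by (intro tendsto_prod)
  then show ?thesis by (simp add: falling_ratio_def)
qed

text \<open>Exposes the coefficients of sin s / s inside those of the Laguerre polynomial. The ratio
  of consecutive left-hand terms is (m - j) / ((j + 3/2)(j + 1)), and 4 (j + 3/2)(j + 1) = (2j +
  3)(2j + 2) advances the odd factorial.\<close>

lemma gbinomial_half_falling_ratio:
  assumes "0 < m" "j \<le> m"
  shows "((real m + 1/2) gchoose (m - j)) / fact j =
    ((real m + 1/2) gchoose m) * falling_ratio m j * (4 * real m) ^ j / fact (2 * j + 1)"
  using \<open>j \<le> m\<close>
proof (induction j)
  case (Suc j)
  define k where "k = m - Suc j"
  have k: "m - j = Suc k" "m - Suc j = k" "real k = real m - real j - 1"
    using Suc.prems by (auto simp: k_def of_nat_diff)
  let ?g = "\<lambda>k. (real m + 1/2) gchoose k"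
  have "(real j + 3/2) * ?g k = (real m - real j) * ?g (Suc k)"
    using gbinomial_mult_1[of "real m + 1/2" k] k(3) by (simp add: algebra_simps)
  then have "?g k = (real m - real j) * ?g (Suc k) / (real j + 3/2)"
    by (subst eq_divide_eq) (auto simp: mult.commute)
  then have "?g k / fact (Suc j) = ?g (Suc k) / fact j * ((real m - real j) / ((real j + 3/2) * (real j + 1)))"
    by (simp add: mult_ac)
  also have "?g (Suc k) / fact j = ?g m * falling_ratio m j * (4 * real m) ^ j / fact (2 * j + 1)"
    using Suc k by simp
  also have "\<dots> * ((real m - real j) / ((real j + 3/2) * (real j + 1))) =
      ?g m * falling_ratio m (Suc j) * (4 * real m) ^ Suc j / fact (2 * Suc j + 1)"
  proof -
    have "fact (2 * Suc j + 1) = 4 * ((real j + 3/2) * (real j + 1)) * fact (2 * j + 1)"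
      by (simp add: field_simps)
    moreover have "falling_ratio m (Suc j) = falling_ratio m j * (real m - real j) / real m"
      using \<open>0 < m\<close> by (simp add: falling_ratio_def field_simps)
    ultimately show ?thesis
      using \<open>0 < m\<close> by (simp del: fact_Suc) (simp only: mult_ac)
  qed
  finally show ?case by (simp only: k)
qed (simp add: falling_ratio_def)

text \<open>For positive m this is the Laguerre polynomial of parameter 1/2 at s^2 / (4 m), divided
  by its value at 0.\<close>

definition scaled_laguerre :: "nat \<Rightarrow> real \<Rightarrow> real" where
  "scaled_laguerre m s = (\<Sum>j\<le>m. (-1) ^ j * falling_ratio m j * s ^ (2 * j) / fact (2 * j + 1))"

text \<open>The Mehler--Heine scaling: coefficientwise the right-hand side tends to the series of sinc.\<close>

lemma poly_laguerre_poly_half: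
  assumes "0 < m"
  shows "poly (laguerre_poly (1/2) m) ((s / (2 * sqrt m))\<^sup>2) =
    ((real m + 1/2) gchoose m) * scaled_laguerre m s"
  unfolding poly_laguerre_poly scaled_laguerre_def sum_distrib_left
proof (rule sum.cong[OF refl])
  fix j assume "j \<in> {..m}"
  then have j: "j \<le> m" by simp
  have "((s / (2 * sqrt m))\<^sup>2) ^ j = s ^ (2 * j) / (4 * real m) ^ j"
    by (simp add: power_divide power_mult power_mult_distrib)
  then have "((real m + 1/2) gchoose (m - j)) * (-1) ^ j / fact j * ((s / (2 * sqrt m))\<^sup>2) ^ j =
     ((real m + 1/2) gchoose (m - j)) / fact j * ((-1) ^ j * s ^ (2 * j) / (4 * real m) ^ j)"
    by simp
  also have "\<dots> = ((real m + 1/2) gchoose m) * ((-1) ^ j * falling_ratio m j * s ^ (2 * j) / fact (2 * j + 1))"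
    unfolding gbinomial_half_falling_ratio[OF assms j] using assms by (simp del: fact_Suc)
  finally show "((real m + 1/2) gchoose (m - j)) * (-1) ^ j / fact j * ((s / (2 * sqrt m))\<^sup>2) ^ j =
     ((real m + 1/2) gchoose m) * ((-1) ^ j * falling_ratio m j * s ^ (2 * j) / fact (2 * j + 1))" .
qed

lemma sinc_sums: "(\<lambda>j. (-1) ^ j * s ^ (2 * j) / fact (2 * j + 1)) sums sinc s"
proof (cases "s = 0")
  case True
  have "(\<lambda>j. (-1) ^ j * s ^ (2 * j) / fact (2 * j + 1)) sums
      (\<Sum>j\<in>{0}. (-1) ^ j * s ^ (2 * j) / fact (2 * j + 1))"
    by (rule sums_finite) (auto simp: True)
  then show ?thesis
    by (simp add: True)
next
  case False
  then show ?thesis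
    using sums_mult[OF sin_paired[of s], of "1 / s"] by (simp add: field_simps)
qed

lemma summable_sinc_majorant: "summable (\<lambda>j. R ^ (2 * j) / fact (2 * j + 1) :: real)"
proof (rule summable_comparison_test)
  show "summable (\<lambda>j. (R\<^sup>2) ^ j / fact j)"
    using summable_exp[of "R\<^sup>2"] by (simp add: field_simps)
  have "fact j \<le> (fact (2 * j + 1) :: real)" for j
    by (rule fact_mono) simp
  then show "\<exists>N. \<forall>j\<ge>N. norm (R ^ (2 * j) / fact (2 * j + 1)) \<le> (R\<^sup>2) ^ j / fact j"
    by (auto simp: power_mult intro!: frac_le)
qed

text \<open>Absolute values of the termwise differences to the sinc series, taken at the endpoint R:
  this makes the bound uniform over |s| <= R.\<close>

definition scaled_laguerre_error :: "real \<Rightarrow> nat \<Rightarrow> real" where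
  "scaled_laguerre_error R m = (\<Sum>j. (1 - falling_ratio m j) * (R ^ (2 * j) / fact (2 * j + 1)))"

text \<open>As \<open>falling_ratio\<close> vanishes beyond m, the finite sum is a full series and
  can be subtracted from that of sinc term by term.\<close>

lemma scaled_laguerre_error_bound:
  assumes "0 < m" "\<bar>s\<bar> \<le> R"
  shows "\<bar>scaled_laguerre m s - sinc s\<bar> \<le> scaled_laguerre_error R m"
proof -
  let ?M = "\<lambda>j. R ^ (2 * j) / fact (2 * j + 1) :: real"
  let ?t = "\<lambda>j. (-1) ^ j * s ^ (2 * j) / fact (2 * j + 1) :: real"
  note b = falling_ratio_bounds[OF \<open>0 < m\<close>]
  have S0: "(\<lambda>j. falling_ratio m j * ?t j) sums (\<Sum>j\<le>m. falling_ratio m j * ?t j)"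
    by (rule sums_finite) (auto simp: falling_ratio_eq_0[OF \<open>0 < m\<close>])
  have F: "scaled_laguerre m s = (\<Sum>j\<le>m. falling_ratio m j * ?t j)"
    unfolding scaled_laguerre_def by (simp add: mult_ac)
  from sums_diff[OF sinc_sums[of s] S0]
  have D: "(\<lambda>j. (1 - falling_ratio m j) * ?t j) sums (sinc s - scaled_laguerre m s)"
    by (simp only: F left_diff_distrib mult_1_left)
  have S: "summable (\<lambda>j. (1 - falling_ratio m j) * ?M j)"
    by (rule summable_comparison_test[OF _ summable_sinc_majorant[of R]])
      (use b in \<open>auto simp: abs_mult power_mult intro!: exI[of _ 0] mult_left_le_one_le divide_right_mono\<close>)
  have le: "norm ((1 - falling_ratio m j) * ?t j) \<le> (1 - falling_ratio m j) * ?M j" for j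
    using b[of j] power_mono[OF \<open>\<bar>s\<bar> \<le> R\<close>, of "2 * j"]
    by (auto simp: abs_mult power_abs power_mult intro!: mult_left_mono divide_right_mono)
  have "norm (\<Sum>j. (1 - falling_ratio m j) * ?t j) \<le> (\<Sum>j. (1 - falling_ratio m j) * ?M j)"
    by (rule norm_suminf_le[OF le S])
  then show ?thesis
    using sums_unique[OF D] by (simp add: scaled_laguerre_error_def abs_minus_commute)
qed

lemma scaled_laguerre_error_tendsto: "scaled_laguerre_error R \<longlonglongrightarrow> 0"
proof -
  let ?M = "\<lambda>j. R ^ (2 * j) / fact (2 * j + 1) :: real"
  have "((\<lambda>m. \<Sum>j. (1 - falling_ratio m j) * ?M j) \<longlonglongrightarrow> (\<Sum>j. 0))"
  proof (rule conjunct2[OF conjunct2[OF tannerys_theorem]])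
    show "(\<lambda>m. (1 - falling_ratio m j) * ?M j) \<longlonglongrightarrow> 0" for j
      using tendsto_mult_right[OF tendsto_diff[OF tendsto_const[of 1] falling_ratio_tendsto[of j]], of "?M j"]
      by simp
    have "norm ((1 - falling_ratio m j) * ?M j) \<le> ?M j" if "0 < m" for m j
      using falling_ratio_bounds[OF that, of j]
      by (auto simp: abs_mult power_mult intro!: mult_left_le_one_le divide_right_mono)
    then show "\<forall>\<^sub>F (j, m) in sequentially \<times>\<^sub>F sequentially. norm ((1 - falling_ratio m j) * ?M j) \<le> ?M j"
      unfolding eventually_prod_filter
      by (intro exI[of _ "\<lambda>_. True"] exI[of _ "\<lambda>m. 0 < m"]) (auto simp: eventually_gt_at_top)
  qed (use summable_sinc_majorant in auto)
  then show ?thesis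
    by (simp add: scaled_laguerre_error_def[abs_def])
qed

text \<open>Source of the factor 2 / pi in the final limit. Negating the upper index gives (-1)^m
  binom(-3/2, m), which grows like sqrt m / Gamma(3/2) with Gamma(3/2) = sqrt pi / 2.\<close>

lemma gbinomial_half_asymptotic:
  "(\<lambda>m. ((real m + 1/2) gchoose m) / (sqrt pi * sqrt m)) \<longlonglongrightarrow> 2 / pi"
proof -
  have "(1/2 :: real) \<notin> \<int>\<^sub>\<le>\<^sub>0"
    using nonpos_Ints_nonpos[of "1/2 :: real"] by auto
  then have "Gamma (3/2 :: real) = sqrt pi / 2"
    using Gamma_plus1[of "1/2 :: real"] by (simp add: Gamma_one_half_real)
  then have G: "inverse (Gamma (3/2 :: real)) = 2 / sqrt pi"
    by (metis inverse_divide)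
  have "(\<lambda>m. ((-3/2) gchoose m) / ((-1) ^ m / exp ((-3/2 + 1) * ln (real m)))) \<longlonglongrightarrow> 2 / sqrt pi"
    using gbinomial_asymptotic[of "-3/2 :: real"] by (simp add: G)
  then have "(\<lambda>m. ((-3/2) gchoose m) / ((-1) ^ m / exp ((-3/2 + 1) * ln (real m))) / sqrt pi) \<longlonglongrightarrow> 2 / sqrt pi / sqrt pi"
    by (rule tendsto_divide[OF _ tendsto_const]) simp
  moreover have "\<forall>\<^sub>F m in sequentially.
     ((-3/2) gchoose m) / ((-1) ^ m / exp ((-3/2 + 1) * ln (real m))) / sqrt pi =
     ((real m + 1/2) gchoose m) / (sqrt pi * sqrt m)"
    using eventually_gt_at_top[of 0]
  proof eventually_elim
    case (elim m)
    have "exp ((-3/2 + 1) * ln (real m)) = 1 / sqrt m"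
      using elim by (simp add: powr_half_sqrt[symmetric] powr_def exp_minus field_simps)
    moreover have "((real m + 1/2) gchoose m) = (-1) ^ m * ((-3/2) gchoose m)"
      by (subst gbinomial_negated_upper) simp
    ultimately show ?case
      by (cases "even m") (simp_all add: mult_ac)
  qed
  ultimately show ?thesis
    by (auto intro: Lim_transform_eventually)
qed

section \<open>The rescaled expansion compared with the sine integral\<close>

text \<open>The half degree of the derivative of the \<open>n\<close>-th expansion.\<close>

definition hermite_index :: "nat \<Rightarrow> nat" where
  "hermite_index n = (n - 1) div 2"

text \<open>The slope at \<open>0\<close> of the expansion after the substitution \<open>x = s / (2 * sqrt m)\<close>.\<close>

definition hermite_gain :: "nat \<Rightarrow> real" where
  "hermite_gain m = ((real m + 1/2) gchoose m) / (sqrt pi * sqrt m)"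

lemma hermite_gain_pos: "0 < m \<Longrightarrow> 0 < hermite_gain m"
  unfolding hermite_gain_def gbinomial_pochhammer'
  by (intro divide_pos_pos mult_pos_pos pochhammer_pos) auto

text \<open>The factor 2 sqrt m is cancelled by the chain rule for x = s / (2 sqrt m), so in the
  variable s the slope is \<open>hermite_gain m * scaled_laguerre m s\<close>.\<close>

lemma poly_pderiv_hermite_expansion_scaled:
  assumes "0 < hermite_index n"
  defines "m \<equiv> hermite_index n"
  shows "poly (pderiv (hermite_expansion n sgn)) (s / (2 * sqrt m)) =
    2 * sqrt m * hermite_gain m * scaled_laguerre m s"
proof -
  have n: "0 < n" and m: "0 < m"
    using assms by (auto simp: hermite_index_def intro: gr0I)
  show ?thesis
    unfolding poly_pderiv_hermite_expansion_sgn[OF n] m_def[unfolded hermite_index_def, symmetric]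
    using m by (simp add: poly_pcompose poly_monom poly_laguerre_poly_half hermite_gain_def)
qed

text \<open>The difference vanishes at 0 and its slope in s is the gain times
  \<open>scaled_laguerre m s - sinc s\<close>, so the mean value inequality on [0, s]
  applies.\<close>

lemma hermite_expansion_sgn_Si:
  assumes "0 < hermite_index n" "0 \<le> s" "s \<le> R"
  defines "m \<equiv> hermite_index n"
  shows "\<bar>poly (hermite_expansion n sgn) (s / (2 * sqrt m)) - hermite_gain m * Si s\<bar> \<le>
    hermite_gain m * scaled_laguerre_error R m * s"
proof -
  have m: "0 < m" using assms by simp
  let ?P = "hermite_expansion n sgn"
  let ?g = "\<lambda>s. poly ?P (s / (2 * sqrt m)) - hermite_gain m * Si s"
  have d: "(?g has_real_derivative hermite_gain m * (scaled_laguerre m x - sinc x)) (at x within {0..s})" for x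
  proof -
    have "((\<lambda>s. poly ?P (s / (2 * sqrt m))) has_real_derivative
        poly (pderiv ?P) (x / (2 * sqrt m)) * (1 / (2 * sqrt m))) (at x within {0..s})"
      by (rule DERIV_chain2[OF poly_DERIV DERIV_cdivide[OF DERIV_ident]])
    then have "((\<lambda>s. poly ?P (s / (2 * sqrt m))) has_real_derivative
        hermite_gain m * scaled_laguerre m x) (at x within {0..s})"
      using m unfolding m_def poly_pderiv_hermite_expansion_scaled[OF assms(1)] by simp
    then show ?thesis
      using DERIV_cmult[OF has_field_derivative_at_within[OF DERIV_Si], of "hermite_gain m"]
      unfolding right_diff_distrib by (intro DERIV_diff)
  qed
  have "norm (?g s - ?g 0) \<le> hermite_gain m * scaled_laguerre_error R m * norm (s - 0)"
  proof (rule field_differentiable_bound[OF convex_real_interval(5) d])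
    fix x assume "x \<in> {0..s}"
    then have "\<bar>scaled_laguerre m x - sinc x\<bar> \<le> scaled_laguerre_error R m"
      using assms by (intro scaled_laguerre_error_bound) (auto simp: m_def)
    then show "norm (hermite_gain m * (scaled_laguerre m x - sinc x)) \<le>
        hermite_gain m * scaled_laguerre_error R m"
      using hermite_gain_pos[OF m] unfolding real_norm_def abs_mult by simp
  qed (use assms in auto)
  moreover have "Si 0 = 0"
    by (simp add: Si_def zero_ereal_def[symmetric])
  ultimately show ?thesis
    using assms by (simp add: hermite_expansion_sgn_at_0)
qed

section \<open>Location of the smallest positive critical point\<close>

lemma sinc_pos: "0 \<le> x \<Longrightarrow> x < pi \<Longrightarrow> 0 < sinc x"
  by (auto intro!: divide_pos_pos sin_gt_zero)

text \<open>On the compact interval sinc has a positive minimum, and it is negative at pi +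
  \<delta>; eventually the uniform error is below both margins. The bound on \<delta> keeps all
  points in [0, 4], where the error for R = 4 applies.\<close>

lemma scaled_laguerre_sign_change:
  assumes "0 < \<delta>" "\<delta> < 4 - pi"
  shows "\<forall>\<^sub>F m in sequentially.
    (\<forall>s\<in>{0..pi - \<delta>}. 0 < scaled_laguerre m s) \<and> scaled_laguerre m (pi + \<delta>) < 0"
proof -
  have "pi > 3" by (rule pi_gt3)
  then have ne: "{0..pi - \<delta>} \<noteq> {}" using assms by auto
  obtain x0 where x0: "x0 \<in> {0..pi - \<delta>}" "\<And>s. s \<in> {0..pi - \<delta>} \<Longrightarrow> sinc x0 \<le> sinc s"
    using continuous_attains_inf[OF compact_Icc ne continuous_on_sinc[OF continuous_on_id]] by blast
  have "0 < sinc x0"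
    using x0(1) assms by (intro sinc_pos) auto
  moreover have neg: "sinc (pi + \<delta>) < 0"
    using assms \<open>pi > 3\<close> sin_gt_zero[of \<delta>] by (auto simp: divide_less_0_iff)
  ultimately have "0 < min (sinc x0) (- sinc (pi + \<delta>))"
    by simp
  from order_tendstoD(2)[OF scaled_laguerre_error_tendsto[of 4] this] eventually_gt_at_top[of 0]
  show ?thesis
  proof eventually_elim
    case (elim m)
    have "0 < scaled_laguerre m s" if "s \<in> {0..pi - \<delta>}" for s
      using scaled_laguerre_error_bound[OF elim(2), of s 4] x0(2)[OF that] that assms elim(1)
      by (auto simp del: if_split)
    moreover have "scaled_laguerre m (pi + \<delta>) < 0"
      using scaled_laguerre_error_bound[OF elim(2), of "pi + \<delta>" 4] assms elim(1) \<open>pi > 3\<close>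
      by (auto simp del: if_split)
    ultimately show ?case by blast
  qed
qed

lemma filterlim_hermite_index: "filterlim hermite_index at_top sequentially"
  unfolding filterlim_at_top
proof
  fix Z
  show "\<forall>\<^sub>F n in sequentially. Z \<le> hermite_index n"
    using eventually_ge_at_top[of "2 * Z + 1"]
    by eventually_elim (auto simp: hermite_index_def)
qed

text \<open>In the variable s the critical points are the zeros of \<open>scaled_laguerre\<close>:
  there is none in [0, pi - \<delta>], and the sign change forces one by pi + \<delta>.\<close>

lemma critical_point_hermite_expansion_near:
  assumes "0 < \<delta>" "\<delta> < 4 - pi"
  shows "\<forall>\<^sub>F n in sequentially.
    (\<exists>x. smallest_pos_critical_point (hermite_expansion n sgn) x) \<and>
    (\<forall>x. smallest_pos_critical_point (hermite_expansion n sgn) x \<longrightarrow>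
      \<bar>2 * sqrt (hermite_index n) * x - pi\<bar> \<le> \<delta>)"
  using eventually_compose_filterlim[OF scaled_laguerre_sign_change[OF assms] filterlim_hermite_index]
    eventually_compose_filterlim[OF eventually_gt_at_top[of 0] filterlim_hermite_index]
proof eventually_elim
  case (elim n)
  define m where "m = hermite_index n"
  let ?P = "hermite_expansion n sgn"
  have m: "0 < m" using elim by (simp add: m_def)
  have sub: "poly (pderiv ?P) (s / (2 * sqrt m)) = 2 * sqrt m * hermite_gain m * scaled_laguerre m s" for s
    unfolding m_def by (rule poly_pderiv_hermite_expansion_scaled[OF elim(2)])
  have crit: "critical_point ?P (s / (2 * sqrt m)) \<longleftrightarrow> scaled_laguerre m s = 0" for s
    unfolding critical_point_def sub using m hermite_gain_pos[OF m] by simp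
  have crit': "critical_point ?P x \<longleftrightarrow> scaled_laguerre m (2 * sqrt m * x) = 0" for x
    using crit[of "2 * sqrt m * x"] m by simp
  have pos: "0 < scaled_laguerre m s" if "0 \<le> s" "s \<le> pi - \<delta>" for s
    using elim(1) that by (auto simp: m_def)
  have neg: "scaled_laguerre m (pi + \<delta>) < 0"
    using elim(1) by (simp add: m_def)
  have "pi > 3" by (rule pi_gt3)
  have "\<exists>s\<ge>pi - \<delta>. s \<le> pi + \<delta> \<and> scaled_laguerre m s = 0"
  proof (rule IVT2')
    show "continuous_on {pi - \<delta>..pi + \<delta>} (scaled_laguerre m)"
      unfolding scaled_laguerre_def by (intro continuous_intros) auto
  qed (use neg pos[of "pi - \<delta>"] assms \<open>pi > 3\<close> in auto)
  then obtain z where z: "pi - \<delta> \<le> z" "z \<le> pi + \<delta>" "scaled_laguerre m z = 0"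
    by blast
  have z0: "0 < z / (2 * sqrt m)"
    using z m assms \<open>pi > 3\<close> by simp
  let ?C = "{x. 0 < x \<and> critical_point ?P x}"
  \<comment> \<open>A nonzero derivative has finitely many roots, so the nonempty set of positive
    critical points has a minimum.\<close>
  have "pderiv ?P \<noteq> 0"
  proof
    assume "pderiv ?P = 0"
    with sub[of "pi + \<delta>"] neg m hermite_gain_pos[OF m] show False by simp
  qed
  then have fin: "finite ?C"
    by (rule finite_subset[rotated, OF poly_roots_finite]) (auto simp: critical_point_def)
  have C: "z / (2 * sqrt m) \<in> ?C"
    using z0 z(3) crit by simp
  have "smallest_pos_critical_point ?P (Min ?C)"
    using Min_in[OF fin] Min_le[OF fin] C unfolding smallest_pos_critical_point_def by blast
  moreover have "\<bar>2 * sqrt m * x - pi\<bar> \<le> \<delta>" if x: "smallest_pos_critical_point ?P x" for x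
  proof -
    have "x \<le> z / (2 * sqrt m)"
      using x C by (auto simp: smallest_pos_critical_point_def)
    then have "2 * sqrt m * x \<le> pi + \<delta>"
      using z(2) m by (simp add: field_simps)
    moreover have "pi - \<delta> < 2 * sqrt m * x"
      using x pos[of "2 * sqrt m * x"] m
      by (fastforce simp: smallest_pos_critical_point_def crit' not_less)
    ultimately show ?thesis by simp
  qed
  ultimately show ?case by (auto simp: m_def)
qed

section \<open>Passage to the limit\<close>

lemma Si_pi: "Si pi = (LBINT t:{0..pi}. sin t / t)"
  unfolding Si_def zero_ereal_def by (rule interval_integral_Icc) simp

theorem theorem2:
  shows "(\<forall>\<^sub>F n in sequentially.
            \<exists>x. smallest_pos_critical_point (hermite_expansion n sgn) x) \<and>
         (\<forall>xp :: nat \<Rightarrow> real.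
            (\<forall>\<^sub>F n in sequentially.
               smallest_pos_critical_point (hermite_expansion n sgn) (xp n)) \<longrightarrow>
            (\<lambda>n. poly (hermite_expansion n sgn) (xp n))
              \<longlonglongrightarrow> 2 / pi * (LBINT t:{0..pi}. sin t / t))"
proof (intro conjI allI impI)
  have pi4: "0 < (4 - pi) / 2" using pi_less_4 by simp
  show "\<forall>\<^sub>F n in sequentially. \<exists>x. smallest_pos_critical_point (hermite_expansion n sgn) x"
    using critical_point_hermite_expansion_near[of "(4 - pi) / 2"] pi4
    by (auto elim: eventually_mono)
next
  fix xp :: "nat \<Rightarrow> real"
  assume xp: "\<forall>\<^sub>F n in sequentially. smallest_pos_critical_point (hermite_expansion n sgn) (xp n)"
  define s where "s n = 2 * sqrt (hermite_index n) * xp n" for n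
  define g where "g n = hermite_gain (hermite_index n)" for n
  have s: "s \<longlonglongrightarrow> pi"
  proof (rule tendstoI)
    fix e :: real assume "0 < e"
    \<comment> \<open>The first entry gives closeness strictly below e, the second the bound
      required for the sign change.\<close>
    define \<delta> where "\<delta> = min (e / 2) ((4 - pi) / 2)"
    have "0 < \<delta>" "\<delta> < 4 - pi" "\<delta> < e"
      using \<open>0 < e\<close> pi_less_4 by (auto simp: \<delta>_def min_def)
    from critical_point_hermite_expansion_near[OF this(1,2)] xp
    show "\<forall>\<^sub>F n in sequentially. dist (s n) pi < e"
    proof eventually_elim
      case (elim n)
      then show ?case
        using \<open>\<delta> < e\<close> by (fastforce simp: s_def dist_real_def)
    qed
  qed
  have g: "g \<longlonglongrightarrow> 2 / pi"
    unfolding g_def hermite_gain_def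
    by (rule filterlim_compose[OF gbinomial_half_asymptotic filterlim_hermite_index])
  have e: "(\<lambda>n. scaled_laguerre_error 4 (hermite_index n)) \<longlonglongrightarrow> 0"
    by (rule filterlim_compose[OF scaled_laguerre_error_tendsto filterlim_hermite_index])
  have "(\<lambda>n. Si (s n)) \<longlonglongrightarrow> Si pi"
    by (rule isCont_tendsto_compose[OF isCont_Si s])
  with g have lim: "(\<lambda>n. g n * Si (s n)) \<longlonglongrightarrow> 2 / pi * Si pi"
    by (rule tendsto_mult)
  have "(\<lambda>n. g n * scaled_laguerre_error 4 (hermite_index n) * s n) \<longlonglongrightarrow> 2 / pi * 0 * pi"
    by (intro tendsto_mult g e s)
  then have err: "(\<lambda>n. g n * scaled_laguerre_error 4 (hermite_index n) * s n) \<longlonglongrightarrow> 0"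
    by simp
  have "(\<lambda>n. poly (hermite_expansion n sgn) (xp n) - g n * Si (s n)) \<longlonglongrightarrow> 0"
  proof (rule Lim_null_comparison[OF _ err])
    \<comment> \<open>Since s tends to pi, which lies strictly between 0 and 4, eventually s n lies
      in [0, 4] and the estimate with R = 4 applies.\<close>
    show "\<forall>\<^sub>F n in sequentially. norm (poly (hermite_expansion n sgn) (xp n) - g n * Si (s n))
        \<le> g n * scaled_laguerre_error 4 (hermite_index n) * s n"
      using order_tendstoD(1)[OF s pi_gt_zero] order_tendstoD(2)[OF s pi_less_4]
        eventually_compose_filterlim[OF eventually_gt_at_top[of 0] filterlim_hermite_index]
    proof eventually_elim
      case (elim n)
      then show ?case
        using hermite_expansion_sgn_Si[of n "s n" 4] by (simp add: g_def s_def)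
    qed
  qed
  from tendsto_add[OF this lim]
  show "(\<lambda>n. poly (hermite_expansion n sgn) (xp n)) \<longlonglongrightarrow> 2 / pi * (LBINT t:{0..pi}. sin t / t)"
    by (simp add: Si_pi)
qed

end
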